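(* For integers $1\le i\le m$, $1\le j\le n$, $m\le n$, the random vector $(X_{i:m},X_{j:n})$ has an absolutely continuous distribution with respect to $\nu$, and its density function (with respect to $\nu$) is of the form $$f_{X_{i:m},X_{j:n}}(x,y)=\sum_{k=i}^{i+n-m}\frac{\binom{k-1}{i-1}\binom{n-k}{m-i}}{\binom{n}{m}}\,f_{k,j:n}(x,y).$$
   Context: $X_1,X_2,\ldots$ are independent identically distributed real random variables whose common distribution is absolutely continuous with respect to Lebesgue measure. $X_{i:m}$ is the $i$-th smallest among $X_1,\ldots,X_m$ (so $X_{1:m}\le\cdots\le X_{m:m}$), and similarly $X_{j:n}$ is the $j$-th smallest among $X_1,\ldots,X_n$. The measure $\nu$ on $\mathbb{R}^2$ is $\nu(S)=\mu_2(S)+\mu_1(\{x\in\mathbb{R}:(x,x)\in S\})$ for Borel $S\subset\mathbb{R}^2$, where $\mu_d$ is Lebesgue measure on $\mathbb{R}^d$. For $1\le k,j\le n$: $f_{j:n}$ is the density of $X_{j:n}$; if $k\ne j$, $f_{k,j:n}$ is the density of $(X_{k:n},X_{j:n})$ with respect to $\mu_2$, in a version with $f_{k,j:n}(s,s)=0$ for all $s\in\mathbb{R}$; if $k=j$, $f_{j,j:n}(s,t)=f_{j:n}(s)\,\delta_{s,t}$ with $\delta_{s,t}$ the Kronecker delta. *)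

theory Defs
  imports "HOL-Probability.Probability"
begin

definition order_stat :: "(nat \<Rightarrow> 'a \<Rightarrow> real) \<Rightarrow> nat \<Rightarrow> nat \<Rightarrow> 'a \<Rightarrow> real" where
  "order_stat X i m \<omega> = sort (map (\<lambda>k. X k \<omega>) [1..<Suc m]) ! (i - 1)"

definition nu :: "(real \<times> real) measure" where
  "nu = measure_of UNIV (sets borel)
     (\<lambda>S. emeasure lborel S + emeasure lborel {x::real. (x, x) \<in> S})"

lemma space_nu [simp]: "space nu = UNIV"
  by (simp add: nu_def space_measure_of_conv)

lemma sets_nu [simp, measurable_cong]: "sets nu = sets borel"
  using sets.sigma_sets_eq[of "borel :: (real \<times> real) measure"]
  by (simp add: nu_def sets_measure_of_conv)

text \<open>\<^const>\<open>measure_of\<close> collapses to the zero measure unless the given set function is a measure;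
  here it is one.\<close>

lemma emeasure_nu:
  assumes "S \<in> sets borel"
  shows "emeasure nu S = emeasure lborel S + emeasure lborel {x::real. (x, x) \<in> S}"
proof (rule emeasure_measure_of[OF nu_def])
  let ?d = "\<lambda>x::real. (x, x)"
  have d: "?d \<in> measurable lborel borel"
    by (simp add: borel_prod[symmetric])
  have diag: "emeasure lborel {x. (x, x) \<in> A} = emeasure (distr lborel borel ?d) A"
    if "A \<in> sets borel" for A
    using that by (subst emeasure_distr[OF d]) (auto simp: vimage_def)
  show "countably_additive (sets nu)
      (\<lambda>S. emeasure lborel S + emeasure lborel {x::real. (x, x) \<in> S})"
  proof (rule countably_additiveI)
    fix A :: "nat \<Rightarrow> (real \<times> real) set"
    assume A: "range A \<subseteq> sets nu" "disjoint_family A" "(\<Union>i. A i) \<in> sets nu"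
    have Ai: "A i \<in> sets borel" for i using A(1) by auto
    have "(\<Sum>i. emeasure lborel (A i) + emeasure lborel {x. (x, x) \<in> A i})
        = (\<Sum>i. emeasure lborel (A i) + emeasure (distr lborel borel ?d) (A i))"
      using diag[OF Ai] by simp
    also have "\<dots> = (\<Sum>i. emeasure lborel (A i)) + (\<Sum>i. emeasure (distr lborel borel ?d) (A i))"
      by (simp add: suminf_add)
    also have "\<dots> = emeasure lborel (\<Union>i. A i) + emeasure (distr lborel borel ?d) (\<Union>i. A i)"
      using Ai A(2) by (subst (1 2) suminf_emeasure) auto
    also have "\<dots> = emeasure lborel (\<Union>i. A i) + emeasure lborel {x. (x, x) \<in> (\<Union>i. A i)}"
      using A(3) by (simp only: diag sets_nu)
    finally show "(\<Sum>i. emeasure lborel (A i) + emeasure lborel {x. (x, x) \<in> A i})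
      = emeasure lborel (\<Union>i. A i) + emeasure lborel {x. (x, x) \<in> (\<Union>i. A i)}" .
  qed
qed (use assms in \<open>auto simp: positive_def\<close>)

text \<open>\<open>f j\<close> is a version of the density of the \<open>j\<close>-th order statistic of a sample of size \<open>n\<close>,
  and, for \<open>k \<noteq> j\<close>, \<open>g k j\<close> is a version, vanishing on the diagonal, of the joint density
  of the \<open>k\<close>-th and \<open>j\<close>-th ones. As usual, a density is everywhere finite and nonnegative.\<close>

definition order_stat_densities ::
  "'a measure \<Rightarrow> (nat \<Rightarrow> 'a \<Rightarrow> real) \<Rightarrow> nat \<Rightarrow>
   (nat \<Rightarrow> real \<Rightarrow> real) \<Rightarrow> (nat \<Rightarrow> nat \<Rightarrow> real \<times> real \<Rightarrow> real) \<Rightarrow> bool" where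
  "order_stat_densities M X n f g \<longleftrightarrow>
     (\<forall>j\<in>{1..n}. (\<forall>x. f j x \<ge> 0) \<and>
        distributed M lborel (order_stat X j n) (\<lambda>x. ennreal (f j x))) \<and>
     (\<forall>k\<in>{1..n}. \<forall>j\<in>{1..n}. k \<noteq> j \<longrightarrow>
        (\<forall>p. g k j p \<ge> 0) \<and> (\<forall>s. g k j (s, s) = 0) \<and>
        distributed M lborel (\<lambda>\<omega>. (order_stat X k n \<omega>, order_stat X j n \<omega>))
          (\<lambda>p. ennreal (g k j p)))"

definition joint_density ::
  "(nat \<Rightarrow> real \<Rightarrow> real) \<Rightarrow> (nat \<Rightarrow> nat \<Rightarrow> real \<times> real \<Rightarrow> real) \<Rightarrow>
   nat \<Rightarrow> nat \<Rightarrow> real \<Rightarrow> real \<Rightarrow> real" where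
  "joint_density f g k j s t =
     (if k = j then f j s * of_bool (s = t) else g k j (s, t))"

end

theory Submission
  imports Defs
begin

text \<open>By exchangeability, the law of \<open>(X\<^bsub>i:m\<^esub>, X\<^bsub>j:n\<^esub>)\<close> does not change when the first \<open>m\<close> observations are
  replaced by those with indices in any \<open>m\<close>-subset \<open>A\<close> of \<open>{1..n}\<close>. Averaged over all \<open>A\<close>, this law
  becomes a mixture of the laws of \<open>(X\<^bsub>k:n\<^esub>, X\<^bsub>j:n\<^esub>)\<close>: for every outcome, ties included, the \<open>i\<close>-th smallest
  observation from \<open>A\<close> is \<open>X\<^bsub>k:n\<^esub>\<close> for exactly \<open>(k-1 choose i-1) * (n-k choose m-i)\<close> of the \<open>m\<close>-subsets.
  It remains to see that \<open>f\<^bsub>k,j:n\<^esub>\<close> is a \<open>\<nu>\<close>-density of \<open>(X\<^bsub>k:n\<^esub>, X\<^bsub>j:n\<^esub>)\<close>: for \<open>k \<noteq> j\<close> it vanishes on the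
  diagonal, and for \<open>k = j\<close> it vanishes off it.

  Absolute continuity holds because the vector always equals one of the pairs \<open>(X\<^bsub>a\<^esub>, X\<^bsub>b\<^esub>)\<close>,
  each of which avoids \<open>\<nu>\<close>-null sets almost surely.\<close>

section \<open>Order statistics over a finite index set\<close>

text \<open>Sorting the multiset of values counts tied observations with multiplicity and does not
  depend on any ordering of \<open>A\<close>. The offset \<open>i - 1\<close> matches ranks starting
  at 1 to list positions starting at 0.\<close>

definition subset_stat :: "(nat \<Rightarrow> real) \<Rightarrow> nat \<Rightarrow> nat set \<Rightarrow> real" where
  "subset_stat x i A = sorted_list_of_multiset (image_mset x (mset_set A)) ! (i - 1)"

lemma order_stat_eq_subset_stat: "order_stat X i m \<omega> = subset_stat (\<lambda>k. X k \<omega>) i {1..m}"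
proof -
  have "image_mset (\<lambda>k. X k \<omega>) (mset_set {1..m}) = mset (map (\<lambda>k. X k \<omega>) [1..<Suc m])"
    unfolding mset_map mset_upt atLeastLessThanSuc_atLeastAtMost ..
  then show ?thesis
    by (simp only: order_stat_def subset_stat_def sorted_list_of_multiset_mset)
qed

lemma subset_stat_cong:
  assumes "\<And>k. k \<in> A \<Longrightarrow> x k = y k"
  shows "subset_stat x i A = subset_stat y i A"
proof -
  have "image_mset x (mset_set A) = image_mset y (mset_set A)"
    \<comment> \<open>\<open>mset_set A\<close> is empty for infinite \<open>A\<close>, so that case
      is trivial.\<close>
    using assms by (cases "finite A") (auto intro!: image_mset_cong)
  then show ?thesis
    by (simp add: subset_stat_def)
qed

text \<open>Injectivity of \<open>\<sigma>\<close> lets it map \<open>mset_set A\<close> to the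
  multiset of the image with every multiplicity one; \<open>x\<close> may still take equal
  values.\<close>

lemma subset_stat_image:
  assumes "inj_on \<sigma> A"
  shows "subset_stat x i (\<sigma> ` A) = subset_stat (\<lambda>k. x (\<sigma> k)) i A"
  using assms by (simp add: subset_stat_def image_mset_mset_set[symmetric] multiset.map_comp comp_def)

text \<open>Listing \<open>A\<close> increasingly already lists the values in order, so sorting
  changes nothing. Weak monotonicity leaves room for ties.\<close>

lemma subset_stat_mono_on:
  assumes "finite A" "mono_on A x" "1 \<le> i" "i \<le> card A"
  shows "subset_stat x i A = x (sorted_list_of_set A ! (i - 1))"
proof -
  have "sort (map x (sorted_list_of_set A)) = map x (sorted_list_of_set A)"
  proof (rule sorted_sort_id)
    show "sorted (map x (sorted_list_of_set A))"
      unfolding sorted_map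
      by (rule sorted_wrt_mono_rel[of _ "(\<le>)"])
        (use assms in \<open>auto dest: mono_onD\<close>)
  qed
  moreover have "image_mset x (mset_set A) = mset (map x (sorted_list_of_set A))"
    using assms(1) by (metis distinct_sorted_list_of_set mset_map mset_set_set set_sorted_list_of_set)
  ultimately show ?thesis
    using assms by (simp only: subset_stat_def sorted_list_of_multiset_mset) simp
qed

lemma subset_stat_in_image:
  assumes "finite A" "1 \<le> i" "i \<le> card A"
  shows "subset_stat x i A \<in> x ` A"
proof -
  let ?l = "sorted_list_of_multiset (image_mset x (mset_set A))"
  have "length ?l = card A"
    by (metis mset_sorted_list_of_multiset size_mset size_image_mset size_mset_set)
  then have "?l ! (i - 1) \<in> set ?l"
    using assms by (intro nth_mem) auto
  also have "set ?l = x ` A"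
    using assms(1) by simp
  finally show ?thesis
    by (simp add: subset_stat_def)
qed

text \<open>The entries not exceeding \<open>c\<close> form an initial segment of a sorted list, so
  the length of that segment decides the comparison.\<close>

lemma sorted_nth_le_iff:
  assumes "sorted l" "p < length l"
  shows "l ! p \<le> c \<longleftrightarrow> p < length (filter (\<lambda>y. y \<le> c) l)"
  using assms
proof (induction l arbitrary: p)
  case (Cons a l)
  show ?case
  proof (cases "a \<le> c")
    case True
    then show ?thesis using Cons by (cases p) auto
  next
    case False
    then have "filter (\<lambda>y. y \<le> c) l = []"
      using Cons.prems by (auto simp: filter_empty_conv)
    moreover have "\<not> (a # l) ! p \<le> c"
      using False Cons.prems by (cases p) (auto dest!: nth_mem)
    ultimately show ?thesis using False by simp
  qed
qed simp

text \<open>Turns a sublevel set of an order statistic into a condition on a count, from which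
  measurability follows.\<close>

lemma subset_stat_le_iff:
  assumes "finite A" "1 \<le> i" "i \<le> card A"
  shows "subset_stat x i A \<le> c \<longleftrightarrow> i \<le> card {k \<in> A. x k \<le> c}"
proof -
  let ?l = "sorted_list_of_multiset (image_mset x (mset_set A))"
  have len: "length ?l = card A"
    by (metis mset_sorted_list_of_multiset size_mset size_image_mset size_mset_set)
  have "length (filter (\<lambda>y. y \<le> c) ?l) = size (filter_mset (\<lambda>y. y \<le> c) (image_mset x (mset_set A)))"
    by (metis mset_filter mset_sorted_list_of_multiset size_mset)
  also have "\<dots> = card {k \<in> A. x k \<le> c}"
    using assms(1) by (simp add: filter_mset_image_mset)
  finally have "length (filter (\<lambda>y. y \<le> c) ?l) = card {k \<in> A. x k \<le> c}" .
  moreover have "?l ! (i - 1) \<le> c \<longleftrightarrow> i - 1 < length (filter (\<lambda>y. y \<le> c) ?l)"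
    using assms len by (intro sorted_nth_le_iff) auto
  ultimately show ?thesis
    using assms by (simp add: subset_stat_def) linarith
qed

lemma measurable_subset_stat:
  assumes "finite A" "1 \<le> i" "i \<le> card A" and [measurable]: "\<And>k. k \<in> A \<Longrightarrow> Y k \<in> borel_measurable M"
  shows "(\<lambda>\<omega>. subset_stat (\<lambda>k. Y k \<omega>) i A) \<in> borel_measurable M"
proof (rule borel_measurableI_le)
  fix c
  \<comment> \<open>Only \<open>Y k\<close> with \<open>k \<in> A\<close> is known to be measurable,
    while \<open>measurable_card\<close> asks about every index; for the others the event is
    empty.\<close>
  have "{\<omega> \<in> space M. k \<in> A \<and> Y k \<omega> \<le> c} \<in> sets M" for k
    by (cases "k \<in> A") auto
  then have [measurable]: "(\<lambda>\<omega>. card {k \<in> A. Y k \<omega> \<le> c}) \<in> measurable M (count_space UNIV)"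
    by (intro measurable_card) simp
  have "{\<omega> \<in> space M. i \<le> card {k \<in> A. Y k \<omega> \<le> c}} \<in> sets M"
    by measurable
  then show "{\<omega> \<in> space M. subset_stat (\<lambda>k. Y k \<omega>) i A \<le> c} \<in> sets M"
    by (simp only: subset_stat_le_iff[OF assms(1-3)])
qed

section \<open>Counting subsets by the rank of one member\<close>

text \<open>The position of a member in the sorted list is the number of smaller members, which
  trades list positions for cardinalities.\<close>

lemma nth_sorted_list_of_set_eq_iff:
  fixes k :: "'b :: linorder"
  assumes "finite B" "p < card B"
  shows "sorted_list_of_set B ! p = k \<longleftrightarrow> k \<in> B \<and> card (B \<inter> {..<k}) = p"
proof -
  let ?l = "sorted_list_of_set B"
  have len: "length ?l = card B" by simp
  have rank: "card (B \<inter> {..<?l ! q}) = q" if "q < card B" for q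
  proof -
    \<comment> \<open>In a strictly sorted list the members below entry \<open>q\<close> are exactly
      the \<open>q\<close> entries before it.\<close>
    have "B \<inter> {..<?l ! q} = (\<lambda>r. ?l ! r) ` {..<q}"
    proof (intro equalityI subsetI)
      fix b assume "b \<in> B \<inter> {..<?l ! q}"
      then have b: "b \<in> B" "b < ?l ! q" by auto
      then obtain r where r: "r < card B" "b = ?l ! r"
        using assms(1) by (metis in_set_conv_nth len set_sorted_list_of_set)
      have "r < q"
        using r b(2) that
        by (metis leD len linorder_not_less sorted_list_of_set.sorted_sorted_key_list_of_set sorted_nth_mono)
      then show "b \<in> (\<lambda>r. ?l ! r) ` {..<q}" using r by auto
    next
      fix b assume "b \<in> (\<lambda>r. ?l ! r) ` {..<q}"
      then obtain r where r: "r < q" "b = ?l ! r" by auto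
      then have "?l ! r \<in> B"
        using that assms(1) nth_mem[of r ?l] by simp
      moreover have "?l ! r < ?l ! q"
        using r that strict_sorted_list_of_set[of B] by (simp add: sorted_wrt_iff_nth_less)
      ultimately show "b \<in> B \<inter> {..<?l ! q}" using r by simp
    qed
    moreover have "inj_on (\<lambda>r. ?l ! r) {..<q}"
      using that by (intro inj_on_nth) auto
    ultimately show ?thesis
      by (simp add: card_image)
  qed
  show ?thesis
  proof
    assume "?l ! p = k"
    then show "k \<in> B \<and> card (B \<inter> {..<k}) = p"
      using rank[OF assms(2)] assms len nth_mem[of p ?l] by auto
  next
    \<comment> \<open>\<open>k\<close> sits at some position \<open>q\<close>, and
      \<open>rank\<close> forces \<open>q = p\<close>.\<close>
    assume k: "k \<in> B \<and> card (B \<inter> {..<k}) = p"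
    then obtain q where "q < card B" "?l ! q = k"
      using assms(1) by (metis in_set_conv_nth len set_sorted_list_of_set)
    with rank[of q] k show "?l ! p = k" by auto
  qed
qed

text \<open>Such a set consists of \<open>k\<close>, a choice of \<open>i - 1\<close> elements below
  it and an independent choice of \<open>m - i\<close> elements above it.\<close>

lemma card_subsets_with_nth:
  assumes "1 \<le> i" "i \<le> m" "k \<in> {1..n}"
  shows "card {B. B \<subseteq> {1..n} \<and> card B = m \<and> sorted_list_of_set B ! (i - 1) = k}
    = ((k - 1) choose (i - 1)) * ((n - k) choose (m - i))"
proof -
  let ?L = "{C. C \<subseteq> {1..<k} \<and> card C = i - 1}" and ?R = "{C. C \<subseteq> {k<..n} \<and> card C = m - i}"
  let ?S = "{B. B \<subseteq> {1..n} \<and> card B = m \<and> sorted_list_of_set B ! (i - 1) = k}"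
  have S: "B \<in> ?S \<longleftrightarrow> B \<subseteq> {1..n} \<and> card B = m \<and> k \<in> B \<and> card (B \<inter> {..<k}) = i - 1" for B
    using nth_sorted_list_of_set_eq_iff[of B "i - 1" k] assms finite_subset[of B "{1..n}"]
    by auto
  have split: "card B = card (B \<inter> {..<k}) + 1 + card (B \<inter> {k<..n})"
    if "B \<subseteq> {1..n}" "k \<in> B" for B
  proof -
    have fin: "finite B" using that finite_subset by blast
    have "B = (B \<inter> {..<k}) \<union> ({k} \<union> (B \<inter> {k<..n}))"
      using that by force
    then have "card B = card ((B \<inter> {..<k}) \<union> ({k} \<union> (B \<inter> {k<..n})))" by simp
    also have "\<dots> = card (B \<inter> {..<k}) + card ({k} \<union> (B \<inter> {k<..n}))"
      using fin by (intro card_Un_disjoint) auto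
    also have "card ({k} \<union> (B \<inter> {k<..n})) = 1 + card (B \<inter> {k<..n})"
      using fin by simp
    finally show ?thesis by simp
  qed
  have join: "(insert k (C \<union> D)) \<inter> {..<k} = C" "(insert k (C \<union> D)) \<inter> {k<..n} = D"
    if "C \<subseteq> {1..<k}" "D \<subseteq> {k<..n}" for C D
    using that by fastforce+
  have "bij_betw (\<lambda>B. (B \<inter> {..<k}, B \<inter> {k<..n})) ?S (?L \<times> ?R)"
  proof (rule bij_betw_byWitness[where f' = "\<lambda>(C, D). insert k (C \<union> D)"])
    show "\<forall>B\<in>?S. (case (B \<inter> {..<k}, B \<inter> {k<..n}) of (C, D) \<Rightarrow> insert k (C \<union> D)) = B"
      unfolding Ball_def S by force
    show "\<forall>a'\<in>?L \<times> ?R. ((case a' of (C, D) \<Rightarrow> insert k (C \<union> D)) \<inter> {..<k},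
        (case a' of (C, D) \<Rightarrow> insert k (C \<union> D)) \<inter> {k<..n}) = a'"
      using join by auto
    show "(\<lambda>B. (B \<inter> {..<k}, B \<inter> {k<..n})) ` ?S \<subseteq> ?L \<times> ?R"
    proof (rule image_subsetI)
      fix B assume "B \<in> ?S"
      then show "(B \<inter> {..<k}, B \<inter> {k<..n}) \<in> ?L \<times> ?R"
        unfolding S using split[of B] assms by fastforce
    qed
    show "(\<lambda>(C, D). insert k (C \<union> D)) ` (?L \<times> ?R) \<subseteq> ?S"
    proof (rule image_subsetI)
      fix a assume "a \<in> ?L \<times> ?R"
      then obtain C D where a: "a = (C, D)" "C \<subseteq> {1..<k}" "card C = i - 1" "D \<subseteq> {k<..n}" "card D = m - i"
        by auto
      have sub: "insert k (C \<union> D) \<subseteq> {1..n}"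
        using a(2,4) assms(3) by fastforce
      have "insert k (C \<union> D) \<in> ?S"
        unfolding S using split[OF sub] sub join[OF a(2,4)] a(3,5) assms(1,2) by simp
      then show "(case a of (C, D) \<Rightarrow> insert k (C \<union> D)) \<in> ?S"
        by (simp add: a(1))
    qed
  qed
  then have "card ?S = card ?L * card ?R"
    by (simp add: bij_betw_same_card card_cartesian_product)
  then show ?thesis
    by (simp add: n_subsets)
qed

text \<open>Sorting the indices by their values yields \<open>\<sigma>\<close>; tied values are why
  monotonicity is only weak.\<close>

lemma sorting_permutation:
  fixes x :: "nat \<Rightarrow> real"
  obtains \<sigma> where "bij_betw \<sigma> {1..n} {1..n}" "mono_on {1..n} (\<lambda>k. x (\<sigma> k))"
proof
  define l where "l = sort_key x [1..<Suc n]"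
  let ?\<sigma> = "\<lambda>k. l ! (k - 1)"
  have len: "length l = n" and dist: "distinct l" and set: "set l = {1..n}"
    by (auto simp: l_def)
  have "bij_betw ((!) l) {..<n} {1..n}"
    using bij_betw_nth[OF dist, of "{..<n}" "{1..n}"] len set by simp
  \<comment> \<open>Shifts ranks \<open>1..n\<close> to list positions starting at 0.\<close>
  moreover have "bij_betw (\<lambda>k. k - 1) {1..n} {..<n}"
    by (rule bij_betw_byWitness[where f' = Suc]) auto
  ultimately show "bij_betw ?\<sigma> {1..n} {1..n}"
    by (auto dest: bij_betw_trans simp: comp_def)
  have "sorted (map x l)"
    by (simp add: l_def)
  then show "mono_on {1..n} (\<lambda>k. x (?\<sigma> k))"
    using len by (auto simp: mono_on_def sorted_iff_nth_mono)
qed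

text \<open>Relabelling the sample in increasing order turns the \<open>m\<close>-subsets of indices into
  the \<open>m\<close>-subsets of ranks.\<close>

lemma sum_subset_stat:
  fixes h :: "real \<Rightarrow> 'b :: semiring_1"
  assumes "1 \<le> i" "i \<le> m" "m \<le> n"
  shows "(\<Sum>A\<in>{A. A \<subseteq> {1..n} \<and> card A = m}. h (subset_stat x i A))
    = (\<Sum>k=1..n. of_nat (((k - 1) choose (i - 1)) * ((n - k) choose (m - i))) * h (subset_stat x k {1..n}))"
proof -
  obtain \<sigma> where bij: "bij_betw \<sigma> {1..n} {1..n}" and mono: "mono_on {1..n} (\<lambda>k. x (\<sigma> k))"
    by (rule sorting_permutation)
  have inj: "inj_on \<sigma> {1..n}" and im: "\<sigma> ` {1..n} = {1..n}"
    using bij by (auto simp: bij_betw_def)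
  let ?Sub = "{A. A \<subseteq> {1..n} \<and> card A = m}"
  let ?b = "\<lambda>B. sorted_list_of_set B ! (i - 1)"
  \<comment> \<open>After relabelling, rank \<open>k\<close> belongs to observation
    \<open>\<sigma> k\<close>, because \<open>k\<close> is the element of \<open>{1..n}\<close> with
    \<open>k - 1\<close> predecessors.\<close>
  have full: "subset_stat x k {1..n} = x (\<sigma> k)" if "k \<in> {1..n}" for k
  proof -
    have "subset_stat x k {1..n} = subset_stat x k (\<sigma> ` {1..n})" by (simp only: im)
    also have "\<dots> = x (\<sigma> (sorted_list_of_set {1..n} ! (k - 1)))"
      unfolding subset_stat_image[OF inj] using that mono by (intro subset_stat_mono_on) auto
    also have "sorted_list_of_set {1..n} ! (k - 1) = k"
    proof -
      have "k - 1 < card {1..n}" using that by simp arith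
      moreover have "{1..n} \<inter> {..<k} = {1..<k}" using that by auto
      then have "card ({1..n} \<inter> {..<k}) = k - 1" by simp
      ultimately show ?thesis
        using that nth_sorted_list_of_set_eq_iff[of "{1..n}" "k - 1" k] by blast
    qed
    finally show ?thesis .
  qed
  \<comment> \<open>Every \<open>m\<close>-subset of indices is the image under
    \<open>\<sigma>\<close> of exactly one \<open>m\<close>-subset \<open>B\<close> of ranks, so the
    sum can run over \<open>B\<close>.\<close>
  have bij_Sub: "bij_betw ((`) \<sigma>) ?Sub ?Sub"
  proof -
    have "bij_betw ((`) \<sigma>) (Pow {1..n}) (Pow {1..n})"
      using bij by (rule bij_betw_Pow)
    then have "bij_betw ((`) \<sigma>) {A \<in> Pow {1..n}. card A = m} {A \<in> Pow {1..n}. card A = m}"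
      by (rule bij_betw_Collect)
        (metis PowD card_image inj inj_on_subset)
    then show ?thesis by simp
  qed
  have b_range: "?b ` ?Sub \<subseteq> {1..n}"
  proof (rule image_subsetI)
    fix B assume B: "B \<in> ?Sub"
    then have "finite B" using finite_subset by blast
    then have "?b B \<in> B"
      using B assms nth_mem[of "i - 1" "sorted_list_of_set B"] by auto
    then show "?b B \<in> {1..n}" using B by auto
  qed
  have "(\<Sum>A\<in>?Sub. h (subset_stat x i A)) = (\<Sum>B\<in>?Sub. h (subset_stat x i (\<sigma> ` B)))"
    using sum.reindex_bij_betw[OF bij_Sub, of "\<lambda>A. h (subset_stat x i A)"] by simp
  also have "\<dots> = (\<Sum>B\<in>?Sub. h (x (\<sigma> (?b B))))"
  proof (rule sum.cong[OF refl])
    fix B assume B: "B \<in> ?Sub"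
    then have "finite B" using finite_subset by blast
    have "subset_stat x i (\<sigma> ` B) = subset_stat (\<lambda>k. x (\<sigma> k)) i B"
      using B inj by (intro subset_stat_image) (auto intro: inj_on_subset)
    also have "\<dots> = x (\<sigma> (?b B))"
      using B \<open>finite B\<close> assms mono by (intro subset_stat_mono_on) (auto intro: mono_on_subset)
    finally show "h (subset_stat x i (\<sigma> ` B)) = h (x (\<sigma> (?b B)))" by simp
  qed
  \<comment> \<open>The sets are grouped by the overall rank \<open>k\<close> of their
    \<open>i\<close>-th member, on which alone the summand depends.\<close>
  also have "\<dots> = (\<Sum>k=1..n. \<Sum>B\<in>{B \<in> ?Sub. ?b B = k}. h (x (\<sigma> (?b B))))"
    using b_range by (intro sum.group[symmetric]) auto
  also have "\<dots> = (\<Sum>k=1..n. of_nat (card {B \<in> ?Sub. ?b B = k}) * h (x (\<sigma> k)))"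
    by (intro sum.cong) auto
  also have "\<dots> = (\<Sum>k=1..n. of_nat (((k - 1) choose (i - 1)) * ((n - k) choose (m - i)))
      * h (subset_stat x k {1..n}))"
  proof (rule sum.cong[OF refl])
    fix k assume k: "k \<in> {1..n}"
    have "{B \<in> ?Sub. ?b B = k} = {B. B \<subseteq> {1..n} \<and> card B = m \<and> ?b B = k}"
      by auto
    then show "of_nat (card {B \<in> ?Sub. ?b B = k}) * h (x (\<sigma> k)) =
      of_nat (((k - 1) choose (i - 1)) * ((n - k) choose (m - i))) * h (subset_stat x k {1..n})"
      using card_subsets_with_nth[OF assms(1,2) k] full[OF k] by simp
  qed
  finally show ?thesis .
qed

section \<open>Exchangeability and the mixture identity\<close>

text \<open>The joint law of the family is a product of equal factors \<open>D\<close>, which any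
  permutation of the coordinates preserves.\<close>

lemma (in prob_space) emeasure_permuted_iid:
  assumes "indep_vars (\<lambda>_. N) X I" "\<And>k. k \<in> I \<Longrightarrow> distr M N (X k) = D"
    and "bij_betw \<sigma> I I" and G: "G \<in> measurable (PiM I (\<lambda>_. N)) K" "S \<in> sets K" and "I \<noteq> {}"
  shows "emeasure M {\<omega> \<in> space M. G (\<lambda>k\<in>I. X (\<sigma> k) \<omega>) \<in> S}
    = emeasure M {\<omega> \<in> space M. G (\<lambda>k\<in>I. X k \<omega>) \<in> S}"
proof -
  have rv: "random_variable N (X k)" if "k \<in> I" for k
    using assms(1) that by (auto simp: indep_vars_def)
  have \<sigma>: "inj_on \<sigma> I" "\<sigma> \<in> I \<rightarrow> I"
    using assms(3) by (auto simp: bij_betw_def)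
  let ?P = "PiM I (\<lambda>_. N)"
  let ?V = "\<lambda>\<omega>. \<lambda>k\<in>I. X k \<omega>" and ?W = "\<lambda>\<omega>. \<lambda>k\<in>I. X (\<sigma> k) \<omega>" and ?r = "\<lambda>x. \<lambda>k\<in>I. x (\<sigma> k)"
  have V: "?V \<in> measurable M ?P" and W: "?W \<in> measurable M ?P" and r: "?r \<in> measurable ?P ?P"
    using \<sigma>(2) by (auto intro!: measurable_restrict rv measurable_component_singleton)
  \<comment> \<open>\<open>D\<close> is specified only through the laws of the \<open>X k\<close>,
    so one index is needed to see that it is a probability measure on the sets of
    \<open>N\<close>.\<close>
  obtain k where "k \<in> I" using \<open>I \<noteq> {}\<close> by auto
  then have D: "prob_space D" "sets D = sets N"
    using prob_space_distr[OF rv[of k]] assms(2)[of k] by auto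
  have law: "distr M ?P ?V = PiM I (\<lambda>_. D)"
    using assms(1,2) rv \<open>I \<noteq> {}\<close> indep_vars_iff_distr_eq_PiM'[of I X "\<lambda>_. N"]
    by (simp cong: PiM_cong)
  \<comment> \<open>The permuted vector is the image of the original one under the coordinate map
    \<open>?r\<close>, which carries the product measure to itself.\<close>
  have "distr M ?P ?W = distr (distr M ?P ?V) ?P ?r"
    using \<sigma>(2) by (subst distr_distr[OF r V]) (auto intro!: distr_cong simp: fun_eq_iff Pi_iff)
  also have "\<dots> = PiM I (\<lambda>_. D)"
    unfolding law using distr_PiM_reindex[of I "\<lambda>_. D" \<sigma> I] D \<sigma>
    by (simp cong: distr_cong sets_PiM_cong)
  finally have eq: "distr M ?P ?W = distr M ?P ?V" by (simp only: law)
  have pre: "G -` S \<inter> space ?P \<in> sets ?P"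
    using G by (rule measurable_sets)
  have "emeasure M {\<omega> \<in> space M. G (U \<omega>) \<in> S} = emeasure (distr M ?P U) (G -` S \<inter> space ?P)"
    if "U \<in> measurable M ?P" for U
    unfolding emeasure_distr[OF that pre]
    using measurable_space[OF that] by (intro arg_cong[where f = "emeasure M"]) auto
  from this[OF V] this[OF W] eq show ?thesis by simp
qed

text \<open>Obtained by integrating \<open>sum_subset_stat\<close> over the sample space. The factor
  \<open>n choose m\<close> on the left avoids division in \<open>ennreal\<close>.\<close>

lemma (in prob_space) emeasure_order_stat_mixture:
  assumes indep: "indep_vars (\<lambda>_. borel) X {1..}"
    and ident: "\<forall>k\<ge>1. distr M borel (X k) = distr M borel (X 1)"
    and ij: "1 \<le> i" "i \<le> m" "1 \<le> j" "j \<le> n" "m \<le> n"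
    and S: "S \<in> sets borel"
  shows "of_nat (n choose m) * emeasure M {\<omega> \<in> space M. (order_stat X i m \<omega>, order_stat X j n \<omega>) \<in> S}
    = (\<Sum>k=1..n. of_nat (((k - 1) choose (i - 1)) * ((n - k) choose (m - i)))
        * emeasure M {\<omega> \<in> space M. (order_stat X k n \<omega>, order_stat X j n \<omega>) \<in> S})"
proof -
  let ?Sub = "{A. A \<subseteq> {1..n} \<and> card A = m}"
  let ?I = "{1..n}"
  let ?x = "\<lambda>\<omega> k. X k \<omega>"
  let ?T = "\<lambda>A i \<omega>. (subset_stat (?x \<omega>) i A, subset_stat (?x \<omega>) j ?I)"
  have rv: "X k \<in> borel_measurable M" if "k \<in> ?I" for k
    using indep that by (auto simp: indep_vars_def)
  have stat: "?T A p \<in> borel_measurable M" if "A \<subseteq> ?I" "1 \<le> p" "p \<le> card A" for A p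
    using that ij rv finite_subset[OF that(1)]
    by (intro borel_measurable_Pair measurable_subset_stat) auto
  have ev: "{\<omega> \<in> space M. ?T A p \<omega> \<in> S} \<in> sets M" if "A \<subseteq> ?I" "1 \<le> p" "p \<le> card A" for A p
    using measurable_sets[OF stat[OF that] S] by (simp add: vimage_def Int_def conj_commute)
  \<comment> \<open>The constant \<open>c\<close> is 1 for the sum over subsets and the product of
    binomials for the sum over ranks.\<close>
  have int: "(\<integral>\<^sup>+\<omega>. c * indicator S (?T A p \<omega>) \<partial>M) = c * emeasure M {\<omega> \<in> space M. ?T A p \<omega> \<in> S}"
    if "A \<subseteq> ?I" "1 \<le> p" "p \<le> card A" for A p c
    unfolding nn_integral_cmult_indicator[OF ev[OF that], symmetric]
    by (intro nn_integral_cong) (simp add: indicator_def)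
  \<comment> \<open>Some permutation of \<open>{1..n}\<close> takes \<open>{1..m}\<close> to
    \<open>A\<close>; it leaves the order statistics of the full sample unchanged.\<close>
  have exch: "emeasure M {\<omega> \<in> space M. ?T A i \<omega> \<in> S} = emeasure M {\<omega> \<in> space M. ?T {1..m} i \<omega> \<in> S}"
    if A: "A \<in> ?Sub" for A
  proof -
    have "finite A" using A finite_subset by blast
    obtain g where g: "bij_betw g {1..m} A"
      using A \<open>finite A\<close> finite_same_card_bij[of "{1..m}" A] by auto
    obtain h where h: "bij_betw h {m<..n} (?I - A)"
    proof -
      have "card {m<..n} = card (?I - A)"
        using A card_Diff_subset[OF \<open>finite A\<close>, of ?I] by auto
      then show ?thesis using that finite_same_card_bij[of "{m<..n}" "?I - A"] by blast
    qed
    define \<sigma> where "\<sigma> k = (if k \<in> {1..m} then g k else h k)" for k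
    have "bij_betw \<sigma> ({1..m} \<union> {m<..n}) (A \<union> (?I - A))"
      unfolding \<sigma>_def using g h by (intro bij_betw_disjoint_Un) auto
    moreover have "{1..m} \<union> {m<..n} = ?I" "A \<union> (?I - A) = ?I"
      using A ij by auto
    ultimately have bij: "bij_betw \<sigma> ?I ?I" by simp
    have "\<sigma> ` {1..m} = g ` {1..m}"
      by (intro image_cong) (simp_all add: \<sigma>_def)
    then have im: "\<sigma> ` {1..m} = A" "\<sigma> ` ?I = ?I"
      using g bij by (simp_all only: bij_betw_def)
    have inj: "inj_on \<sigma> ?I"
      using bij by (simp only: bij_betw_def)
    then have inj2: "inj_on \<sigma> {1..m}"
      by (rule inj_on_subset) (use ij in auto)
    define G where "G x = (subset_stat x i {1..m}, subset_stat x j ?I)" for x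
    have G: "G \<in> measurable (PiM ?I (\<lambda>_. borel)) borel"
      unfolding G_def using ij
      by (intro borel_measurable_Pair measurable_subset_stat[where Y = "\<lambda>k x. x k"]
          measurable_component_singleton) auto
    have G_restrict: "G (\<lambda>k\<in>?I. y k) = G y" for y
      unfolding G_def using ij by (intro arg_cong2[where f = Pair] subset_stat_cong) auto
    have "?T A i \<omega> = G (\<lambda>k. X (\<sigma> k) \<omega>)" for \<omega>
      unfolding G_def
      using subset_stat_image[OF inj2, of "?x \<omega>" i] subset_stat_image[OF inj, of "?x \<omega>" j]
      by (simp only: im)
    then have "{\<omega> \<in> space M. ?T A i \<omega> \<in> S} = {\<omega> \<in> space M. G (\<lambda>k\<in>?I. X (\<sigma> k) \<omega>) \<in> S}"
      by (simp only: G_restrict)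
    also have "emeasure M \<dots> = emeasure M {\<omega> \<in> space M. G (\<lambda>k\<in>?I. X k \<omega>) \<in> S}"
    proof (rule emeasure_permuted_iid[OF _ _ bij G S])
      show "indep_vars (\<lambda>_. borel) X ?I"
        using indep by (rule indep_vars_subset) auto
      show "distr M borel (X k) = distr M borel (X 1)" if "k \<in> ?I" for k
        using ident[rule_format, of k] that by simp
    qed (use ij in auto)
    also have "{\<omega> \<in> space M. G (\<lambda>k\<in>?I. X k \<omega>) \<in> S} = {\<omega> \<in> space M. ?T {1..m} i \<omega> \<in> S}"
      unfolding G_restrict by (simp only: G_def)
    finally show ?thesis .
  qed
  have "of_nat (n choose m) * emeasure M {\<omega> \<in> space M. ?T {1..m} i \<omega> \<in> S}
      = (\<Sum>A\<in>?Sub. emeasure M {\<omega> \<in> space M. ?T A i \<omega> \<in> S})"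
  proof -
    have "(\<Sum>A\<in>?Sub. emeasure M {\<omega> \<in> space M. ?T A i \<omega> \<in> S})
      = (\<Sum>A\<in>?Sub. emeasure M {\<omega> \<in> space M. ?T {1..m} i \<omega> \<in> S})"
      by (rule sum.cong[OF refl exch])
    then show ?thesis
      using n_subsets[of ?I m] by (simp only: sum_constant) simp
  qed
  also have "\<dots> = (\<Sum>A\<in>?Sub. \<integral>\<^sup>+\<omega>. indicator S (?T A i \<omega>) \<partial>M)"
  proof (rule sum.cong[OF refl])
    fix A assume "A \<in> ?Sub"
    then show "emeasure M {\<omega> \<in> space M. ?T A i \<omega> \<in> S} = (\<integral>\<^sup>+\<omega>. indicator S (?T A i \<omega>) \<partial>M)"
      using int[of A i 1] ij by simp
  qed
  also have "\<dots> = (\<integral>\<^sup>+\<omega>. (\<Sum>A\<in>?Sub. indicator S (?T A i \<omega>)) \<partial>M)"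
    using stat ij S
    by (intro nn_integral_sum[symmetric] measurable_compose[OF _ borel_measurable_indicator]) auto
  \<comment> \<open>For a fixed outcome the second coordinate of the pair is a constant inside
    \<open>h\<close>.\<close>
  also have "\<dots> = (\<integral>\<^sup>+\<omega>. (\<Sum>k=1..n. of_nat (((k - 1) choose (i - 1)) * ((n - k) choose (m - i)))
      * indicator S (?T ?I k \<omega>)) \<partial>M)"
    by (intro nn_integral_cong sum_subset_stat[where h = "\<lambda>u. indicator S (u, _)"] ij)
  also have "\<dots> = (\<Sum>k=1..n. \<integral>\<^sup>+\<omega>. of_nat (((k - 1) choose (i - 1)) * ((n - k) choose (m - i)))
      * indicator S (?T ?I k \<omega>) \<partial>M)"
    using stat S
    by (intro nn_integral_sum borel_measurable_times_ennreal borel_measurable_const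
        measurable_compose[OF _ borel_measurable_indicator]) auto
  also have "\<dots> = (\<Sum>k=1..n. of_nat (((k - 1) choose (i - 1)) * ((n - k) choose (m - i)))
      * emeasure M {\<omega> \<in> space M. ?T ?I k \<omega> \<in> S})"
    by (intro sum.cong[OF refl] int) auto
  finally show ?thesis
    unfolding order_stat_eq_subset_stat .
qed

section \<open>Integration against \<open>nu\<close> and densities of pairs\<close>

text \<open>For indicators this is \<open>emeasure_nu\<close>; linearity and monotone limits extend
  it.\<close>

lemma nn_integral_nu:
  assumes "h \<in> borel_measurable borel"
  shows "(\<integral>\<^sup>+p. h p \<partial>nu) = (\<integral>\<^sup>+p. h p \<partial>lborel) + (\<integral>\<^sup>+x. h (x, x) \<partial>lborel)"
  using assms
proof (induction rule: borel_measurable_induct)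
  case (cong f g)
  then show ?case by (simp add: space_borel)
next
  case (set A)
  have "(\<integral>\<^sup>+x. indicator A (x, x) \<partial>lborel) = emeasure lborel {x::real. (x, x) \<in> A}"
  proof -
    have "(\<lambda>x::real. (x, x)) \<in> borel_measurable borel" by measurable
    from measurable_sets[OF this set] have "{x::real. (x, x) \<in> A} \<in> sets lborel"
      by (simp add: vimage_def)
    from nn_integral_indicator[OF this] show ?thesis
      by (simp add: indicator_def cong: nn_integral_cong)
  qed
  then show ?case
    using set by (simp add: emeasure_nu)
next
  case (mult u c)
  have "(\<lambda>x. u (x, x)) \<in> borel_measurable borel"
    using mult(2) by measurable
  then show ?case
    using mult by (simp add: nn_integral_cmult distrib_left)
next
  case (add u v)
  have "(\<lambda>x. u (x, x)) \<in> borel_measurable borel" "(\<lambda>x. v (x, x)) \<in> borel_measurable borel"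
    using add(1,3) by measurable
  then show ?case
    using add by (simp add: nn_integral_add ac_simps)
next
  case (seq U)
  have m: "U i \<in> borel_measurable borel" for i using seq by simp
  have d: "(\<lambda>x. U i (x, x)) \<in> borel_measurable borel" for i
    using m by measurable
  have inc: "incseq (\<lambda>i. \<integral>\<^sup>+p. U i p \<partial>lborel)" "incseq (\<lambda>i. \<integral>\<^sup>+x. U i (x, x) \<partial>lborel)"
    using \<open>incseq U\<close> by (auto simp: incseq_def le_fun_def intro!: nn_integral_mono)
  have "(\<integral>\<^sup>+p. (SUP i. U i p) \<partial>nu) = (SUP i. \<integral>\<^sup>+p. U i p \<partial>nu)"
    using seq m by (intro nn_integral_monotone_convergence_SUP) auto
  also have "\<dots> = (SUP i. (\<integral>\<^sup>+p. U i p \<partial>lborel) + (\<integral>\<^sup>+x. U i (x, x) \<partial>lborel))"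
    using seq by simp
  \<comment> \<open>Both sequences of integrals increase, so the supremum of their sum
    splits.\<close>
  also have "\<dots> = (SUP i. \<integral>\<^sup>+p. U i p \<partial>lborel) + (SUP i. \<integral>\<^sup>+x. U i (x, x) \<partial>lborel)"
    using inc by (intro ennreal_SUP_add) auto
  also have "(SUP i. \<integral>\<^sup>+p. U i p \<partial>lborel) = (\<integral>\<^sup>+p. (SUP i. U i p) \<partial>lborel)"
    using seq m by (intro nn_integral_monotone_convergence_SUP[symmetric]) auto
  also have "(SUP i. \<integral>\<^sup>+x. U i (x, x) \<partial>lborel) = (\<integral>\<^sup>+x. (SUP i. U i (x, x)) \<partial>lborel)"
    using \<open>incseq U\<close> d
    by (intro nn_integral_monotone_convergence_SUP[symmetric]) (auto simp: incseq_def le_fun_def)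
  finally show ?case by (simp add: SUP_apply image_comp)
qed

text \<open>Each vertical line meets the diagonal in a single point, so every inner integral
  vanishes.\<close>

lemma nn_integral_lborel_diagonal:
  fixes f :: "real \<times> real \<Rightarrow> ennreal"
  assumes "\<And>x y. x \<noteq> y \<Longrightarrow> f (x, y) = 0" "f \<in> borel_measurable borel"
  shows "(\<integral>\<^sup>+p. f p \<partial>lborel) = 0"
proof -
  have "(\<integral>\<^sup>+p. f p \<partial>lborel) = (\<integral>\<^sup>+x. \<integral>\<^sup>+y. f (x, y) \<partial>lborel \<partial>lborel)"
    using assms(2) by (subst lborel_prod[symmetric], subst lborel.nn_integral_fst[symmetric])
      (simp_all add: lborel_prod)
  also have "\<dots> = nn_integral lborel (\<lambda>x::real. 0)"
  proof (rule nn_integral_cong)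
    fix x :: real
    have "AE y in lborel. y \<noteq> x" by (rule AE_lborel_singleton)
    then have "AE y in lborel. f (x, y) = 0"
      by eventually_elim (simp add: assms(1))
    then show "(\<integral>\<^sup>+y. f (x, y) \<partial>lborel) = 0"
      by (subst nn_integral_cong_AE[where v = "\<lambda>_. 0"]) auto
  qed
  finally show ?thesis by simp
qed

lemma joint_density_nonneg:
  assumes "order_stat_densities M X n f g" "k \<in> {1..n}" "j \<in> {1..n}"
  shows "joint_density f g k j x y \<ge> 0"
  using assms by (auto simp: joint_density_def order_stat_densities_def)

text \<open>\<open>distributed\<close> gives measurability only after \<open>ennreal\<close>;
  nonnegativity lets \<open>enn2real\<close> undo that map.\<close>

lemma borel_measurable_of_ennreal:
  assumes "(\<lambda>x. ennreal (h x)) \<in> borel_measurable M" "\<And>x. h x \<ge> 0"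
  shows "h \<in> borel_measurable M"
proof -
  have "(\<lambda>x. enn2real (ennreal (h x))) \<in> borel_measurable M"
    using assms(1) by measurable
  then show ?thesis using assms(2) by simp
qed

lemma measurable_joint_density:
  assumes "order_stat_densities M X n f g" "k \<in> {1..n}" "j \<in> {1..n}"
  shows "(\<lambda>p. joint_density f g k j (fst p) (snd p)) \<in> borel_measurable borel"
proof (cases "k = j")
  case True
  have f: "distributed M lborel (order_stat X j n) (\<lambda>x. ennreal (f j x))" "f j x \<ge> 0" for x
    using assms by (simp_all add: order_stat_densities_def)
  have "(\<lambda>x. ennreal (f j x)) \<in> borel_measurable borel"
    using distributed_borel_measurable[OF f(1)] by (simp only: measurable_lborel2)
  then have f_borel: "f j \<in> borel_measurable borel"
    using f(2) by (rule borel_measurable_of_ennreal)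
  have diag: "{p :: real \<times> real. fst p = snd p} \<in> sets borel"
    by (intro borel_closed closed_Collect_eq continuous_intros)
  have "(\<lambda>p. f j (fst p) * indicator {p. fst p = snd p} p) \<in> borel_measurable (borel :: (real \<times> real) measure)"
    by (intro borel_measurable_times borel_measurable_indicator diag measurable_compose[OF _ f_borel]
        borel_measurable_continuous_onI continuous_intros)
  moreover have "joint_density f g k j (fst p) (snd p) = f j (fst p) * indicator {p. fst p = snd p} p" for p
    by (simp add: True joint_density_def indicator_def)
  ultimately show ?thesis by simp
next
  case False
  have g: "distributed M lborel (\<lambda>\<omega>. (order_stat X k n \<omega>, order_stat X j n \<omega>)) (\<lambda>p. ennreal (g k j p))"
    "g k j p \<ge> 0" for p
    using assms False by (cases p, auto simp: order_stat_densities_def)+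
  have "(\<lambda>p. ennreal (g k j p)) \<in> borel_measurable borel"
    using distributed_borel_measurable[OF g(1)] by (simp only: measurable_lborel2)
  then have "g k j \<in> borel_measurable borel"
    using g(2) by (rule borel_measurable_of_ennreal)
  then show ?thesis
    using False by (simp add: joint_density_def)
qed

text \<open>Only one part of \<open>nu\<close> can contribute: the line part when
  \<open>k = j\<close>, by \<open>nn_integral_lborel_diagonal\<close>, and otherwise the plane part,
  since \<open>g k j\<close> is zero on the diagonal.\<close>

lemma nn_integral_joint_density:
  assumes dens: "order_stat_densities M X n f g" and kj: "k \<in> {1..n}" "j \<in> {1..n}"
    and S: "S \<in> sets borel"
  shows "(\<integral>\<^sup>+p. ennreal (joint_density f g k j (fst p) (snd p)) * indicator S p \<partial>nu)
    = emeasure M {\<omega> \<in> space M. (order_stat X k n \<omega>, order_stat X j n \<omega>) \<in> S}"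
proof -
  let ?h = "\<lambda>p. ennreal (joint_density f g k j (fst p) (snd p)) * indicator S p"
  have [measurable]: "S \<in> sets borel" by fact
  have [measurable]: "(\<lambda>p. joint_density f g k j (fst p) (snd p)) \<in> borel_measurable borel"
    by (rule measurable_joint_density[OF dens kj])
  have h: "?h \<in> borel_measurable borel"
    by measurable
  have split: "(\<integral>\<^sup>+p. ?h p \<partial>nu) = (\<integral>\<^sup>+p. ?h p \<partial>lborel) + (\<integral>\<^sup>+x. ?h (x, x) \<partial>lborel)"
    by (rule nn_integral_nu[OF h])
  show ?thesis
  proof (cases "k = j")
    case True
    have dist: "distributed M lborel (order_stat X j n) (\<lambda>x. ennreal (f j x))"
      using dens kj by (auto simp: order_stat_densities_def)
    have diag: "(\<lambda>x::real. (x, x)) \<in> borel_measurable borel" by measurable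
    have A: "{x. (x, x) \<in> S} \<in> sets lborel"
      using measurable_sets[OF diag S] by (simp add: vimage_def)
    have "(\<integral>\<^sup>+p. ?h p \<partial>lborel) = 0"
      using h by (intro nn_integral_lborel_diagonal) (simp_all add: True joint_density_def)
    moreover have "(\<integral>\<^sup>+x. ?h (x, x) \<partial>lborel) = (\<integral>\<^sup>+x. ennreal (f j x) * indicator {x. (x, x) \<in> S} x \<partial>lborel)"
      by (intro nn_integral_cong) (simp add: True joint_density_def indicator_def)
    moreover have "\<dots> = emeasure M {\<omega> \<in> space M. (order_stat X k n \<omega>, order_stat X j n \<omega>) \<in> S}"
      unfolding distributed_emeasure[OF dist A, symmetric]
      by (intro arg_cong[where f = "emeasure M"]) (auto simp: True)
    ultimately show ?thesis using split by simp
  next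
    case False
    have dist: "distributed M lborel (\<lambda>\<omega>. (order_stat X k n \<omega>, order_stat X j n \<omega>)) (\<lambda>p. ennreal (g k j p))"
      and "g k j (s, s) = 0" for s
      using dens kj False by (auto simp: order_stat_densities_def)
    then have "(\<integral>\<^sup>+x. ?h (x, x) \<partial>lborel) = 0"
      using False by (simp add: joint_density_def)
    moreover have "(\<integral>\<^sup>+p. ?h p \<partial>lborel) = (\<integral>\<^sup>+p. ennreal (g k j p) * indicator S p \<partial>lborel)"
      using False by (simp add: joint_density_def)
    moreover have "\<dots> = emeasure M {\<omega> \<in> space M. (order_stat X k n \<omega>, order_stat X j n \<omega>) \<in> S}"
      using S by (subst distributed_emeasure[OF dist, symmetric])
        (auto intro!: arg_cong[where f = "emeasure M"])
    ultimately show ?thesis using split by simp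
  qed
qed

section \<open>Avoidance of null sets by pairs of observations\<close>

text \<open>For \<open>a = b\<close> the pair lies on the diagonal, and the line part of
  \<open>nu\<close> makes the trace of \<open>N\<close> there null. For \<open>a \<noteq> b\<close>
  independence gives a product law, to which Fubini applies.\<close>

lemma (in prob_space) AE_pair_notin_null_set:
  assumes indep: "indep_vars (\<lambda>_. borel) X I" and "a \<in> I" "b \<in> I"
    and ac: "\<And>k. k \<in> I \<Longrightarrow> absolutely_continuous lborel (distr M borel (X k))"
    and N: "N \<in> null_sets nu"
  shows "AE \<omega> in M. (X a \<omega>, X b \<omega>) \<notin> N"
proof -
  have rv[measurable]: "X a \<in> borel_measurable M" "X b \<in> borel_measurable M"
    using indep \<open>a \<in> I\<close> \<open>b \<in> I\<close> by (auto simp: indep_vars_def)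
  have [measurable]: "N \<in> sets borel" using N by (auto simp: null_sets_def)
  have null: "emeasure lborel N = 0" "emeasure lborel {x::real. (x, x) \<in> N} = 0"
    using N by (auto simp: null_sets_def emeasure_nu)
  have diag: "(\<lambda>x::real. (x, x)) \<in> borel_measurable borel" by measurable
  have sets_X: "sets (distr M borel (X k)) = sets lborel" for k by simp
  show ?thesis
  proof (cases "a = b")
    case True
    have "{x::real. (x, x) \<in> N} \<in> null_sets lborel"
      using null(2) measurable_sets[OF diag \<open>N \<in> sets borel\<close>] by (auto simp: null_sets_def vimage_def)
    then have "AE x in lborel. (x, x) \<notin> N"
      by (rule AE_I') auto
    then have "AE x in distr M borel (X a). (x, x) \<notin> N"
      by (rule absolutely_continuous_AE[OF sets_X ac[OF \<open>a \<in> I\<close>]])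
    then show ?thesis
      unfolding True[symmetric] by (rule AE_distrD[OF rv(1)])
  next
    case False
    \<comment> \<open>Restrictions of the family to the disjoint index sets \<open>{a}\<close> and
      \<open>{b}\<close> are independent; evaluating them recovers the two variables.\<close>
    have "indep_var borel ((\<lambda>x. x a) \<circ> (\<lambda>\<omega>. restrict (\<lambda>i. X i \<omega>) {a}))
       borel ((\<lambda>x. x b) \<circ> (\<lambda>\<omega>. restrict (\<lambda>i. X i \<omega>) {b}))"
      using False \<open>a \<in> I\<close> \<open>b \<in> I\<close>
      by (intro indep_var_compose[OF indep_var_restrict[OF indep]] measurable_component_singleton) auto
    then have "indep_var borel (X a) borel (X b)"
      by (simp add: comp_def)
    then have law: "distr M borel (X a) \<Otimes>\<^sub>M distr M borel (X b)
        = distr M (borel \<Otimes>\<^sub>M borel) (\<lambda>\<omega>. (X a \<omega>, X b \<omega>))"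
      by (simp add: indep_var_distribution_eq)
    interpret D: prob_space "distr M borel (X b)" by (rule prob_space_distr) fact
    have N2: "N \<in> sets (lborel \<Otimes>\<^sub>M lborel)" "N \<in> sets (borel \<Otimes>\<^sub>M borel)"
        "N \<in> sets (distr M borel (X a) \<Otimes>\<^sub>M distr M borel (X b))"
    proof -
      have "sets (distr M borel (X a) \<Otimes>\<^sub>M distr M borel (X b)) = sets (borel \<Otimes>\<^sub>M borel)"
        "sets (lborel \<Otimes>\<^sub>M lborel) = sets (borel \<Otimes>\<^sub>M borel :: (real \<times> real) measure)"
        by (intro sets_pair_measure_cong; simp)+
      moreover have "N \<in> sets (borel \<Otimes>\<^sub>M borel)"
        unfolding borel_prod by fact
      ultimately show "N \<in> sets (lborel \<Otimes>\<^sub>M lborel)" "N \<in> sets (borel \<Otimes>\<^sub>M borel)"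
          "N \<in> sets (distr M borel (X a) \<Otimes>\<^sub>M distr M borel (X b))"
        by simp_all
    qed
    have "AE p in lborel \<Otimes>\<^sub>M lborel. p \<notin> N"
      unfolding lborel_prod using null(1) by (intro AE_not_in) (auto simp: null_sets_def)
    then have "AE x in lborel. AE y in lborel. (x, y) \<notin> N"
      by (rule lborel_pair.AE_pair)
    \<comment> \<open>Absolute continuity is applied one coordinate at a time, first to the inner
      law and then to the outer one.\<close>
    then have "AE x in lborel. AE y in distr M borel (X b). (x, y) \<notin> N"
      by eventually_elim (rule absolutely_continuous_AE[OF sets_X ac[OF \<open>b \<in> I\<close>]])
    then have "AE x in distr M borel (X a). AE y in distr M borel (X b). (x, y) \<notin> N"
      by (rule absolutely_continuous_AE[OF sets_X ac[OF \<open>a \<in> I\<close>]])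
    \<comment> \<open>The product measure of \<open>N\<close> is the integral of the measures of its
      sections, which vanish almost everywhere.\<close>
    then have "emeasure (distr M borel (X a) \<Otimes>\<^sub>M distr M borel (X b)) N = 0"
      unfolding D.emeasure_pair_measure_alt[OF N2(3)]
      using N2(3) by (subst nn_integral_0_iff_AE)
        (auto intro!: D.measurable_emeasure_Pair elim!: eventually_mono simp: AE_iff_null vimage_def null_sets_def)
    then have "emeasure (distr M (borel \<Otimes>\<^sub>M borel) (\<lambda>\<omega>. (X a \<omega>, X b \<omega>))) N = 0"
      unfolding law .
    then have "AE p in distr M (borel \<Otimes>\<^sub>M borel) (\<lambda>\<omega>. (X a \<omega>, X b \<omega>)). p \<notin> N"
      using N2(2) by (intro AE_not_in) (auto simp: null_sets_def)
    then show ?thesis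
      by (rule AE_distrD[rotated]) measurable
  qed
qed

section \<open>Absolute continuity and density of the mixed pair\<close>

theorem theorem2p2:
  fixes M :: "'a measure" and X :: "nat \<Rightarrow> 'a \<Rightarrow> real" and i j m n :: nat
  assumes "prob_space M"
    and "prob_space.indep_vars M (\<lambda>_. borel) X {1..}"
    and "\<forall>k\<ge>1. distr M borel (X k) = distr M borel (X 1)"
    and "absolutely_continuous lborel (distr M borel (X 1))"
    and "1 \<le> i" and "i \<le> m" and "1 \<le> j" and "j \<le> n" and "m \<le> n"
  shows "absolutely_continuous nu
           (distr M borel (\<lambda>\<omega>. (order_stat X i m \<omega>, order_stat X j n \<omega>))) \<and>
         (\<forall>f g. order_stat_densities M X n f g \<longrightarrow>
           distributed M nu (\<lambda>\<omega>. (order_stat X i m \<omega>, order_stat X j n \<omega>))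
             (\<lambda>(x, y). ennreal
               (\<Sum>k = i..i + n - m.
                  real ((k - 1) choose (i - 1)) * real ((n - k) choose (m - i)) / real (n choose m)
                    * joint_density f g k j x y)))"
proof (intro conjI allI impI)
  interpret prob_space M by fact
  note ij = assms(5-9)
  let ?T = "\<lambda>k m \<omega>. (order_stat X k m \<omega>, order_stat X j n \<omega>)"
  have rv: "X k \<in> borel_measurable M" if "k \<ge> 1" for k
    using assms(2) that by (auto simp: indep_vars_def)
  have T: "?T i m \<in> borel_measurable M"
    unfolding order_stat_eq_subset_stat
    using ij by (intro borel_measurable_Pair measurable_subset_stat rv) auto
  have ev: "emeasure (distr M borel (?T i m)) S = emeasure M {\<omega> \<in> space M. ?T i m \<omega> \<in> S}"
    if "S \<in> sets borel" for S
    unfolding emeasure_distr[OF T that] by (intro arg_cong[where f = "emeasure M"]) auto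
  show "absolutely_continuous nu (distr M borel (?T i m))"
    unfolding absolutely_continuous_def
  proof
    fix N assume N: "N \<in> null_sets nu"
    then have N_borel: "N \<in> sets borel" by (auto simp: null_sets_def)
    have "AE \<omega> in M. (X a \<omega>, X b \<omega>) \<notin> N" if "a \<in> {1..m}" "b \<in> {1..n}" for a b
    proof (rule AE_pair_notin_null_set[OF assms(2) _ _ _ N])
      show "absolutely_continuous lborel (distr M borel (X k))" if "k \<in> {1..}" for k
        using assms(3)[rule_format, of k] assms(4) that by simp
    qed (use that in auto)
    \<comment> \<open>There are finitely many index pairs, so their exceptional null events can be
      merged.\<close>
    then have "AE \<omega> in M. \<forall>a\<in>{1..m}. \<forall>b\<in>{1..n}. (X a \<omega>, X b \<omega>) \<notin> N"
      by (intro AE_finite_allI) auto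
    then have "AE \<omega> in M. ?T i m \<omega> \<notin> N"
    proof eventually_elim
      case (elim \<omega>)
      have "order_stat X i m \<omega> \<in> (\<lambda>k. X k \<omega>) ` {1..m}" "order_stat X j n \<omega> \<in> (\<lambda>k. X k \<omega>) ` {1..n}"
        unfolding order_stat_eq_subset_stat using ij by (intro subset_stat_in_image; simp)+
      then obtain a b where "order_stat X i m \<omega> = X a \<omega>" "a \<in> {1..m}"
          "order_stat X j n \<omega> = X b \<omega>" "b \<in> {1..n}"
        by (elim imageE)
      with elim show ?case by simp
    qed
    then have "emeasure M {\<omega> \<in> space M. ?T i m \<omega> \<in> N} = 0"
      by (intro emeasure_eq_0_AE) simp
    then show "N \<in> null_sets (distr M borel (?T i m))"
      using N_borel by (simp add: null_sets_def ev)
  qed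
  fix f g assume dens: "order_stat_densities M X n f g"
  let ?N = "\<lambda>k. ((k - 1) choose (i - 1)) * ((n - k) choose (m - i))"
  let ?K = "{i..i + n - m}"
  let ?c = "\<lambda>k. real ((k - 1) choose (i - 1)) * real ((n - k) choose (m - i)) / real (n choose m)"
  let ?d = "\<lambda>k p. joint_density f g k j (fst p) (snd p)"
  let ?F = "\<lambda>p. ennreal (\<Sum>k\<in>?K. ?c k * ?d k p)"
  have K: "?K \<subseteq> {1..n}" using ij by auto
  have j: "j \<in> {1..n}" using ij by auto
  have d: "?d k \<in> borel_measurable borel" if "k \<in> ?K" for k
    using measurable_joint_density[OF dens _ j] K that by blast
  have F: "?F \<in> borel_measurable borel"
    by (intro measurable_compose[OF _ measurable_ennreal] borel_measurable_sum
        borel_measurable_times borel_measurable_const d)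
  \<comment> \<open>\<open>ennreal\<close> sends negative numbers to 0; nonnegativity of the
    summands is what lets it pass through the sum.\<close>
  have F_eq: "?F p = (\<Sum>k\<in>?K. ennreal (?c k) * ennreal (?d k p))" for p
  proof -
    have "?F p = (\<Sum>k\<in>?K. ennreal (?c k * ?d k p))"
    proof (rule sum_ennreal[symmetric])
      fix k assume "k \<in> ?K"
      then have "?d k p \<ge> 0" using joint_density_nonneg[OF dens _ j] K by blast
      then show "?c k * ?d k p \<ge> 0" by simp
    qed
    also have "\<dots> = (\<Sum>k\<in>?K. ennreal (?c k) * ennreal (?d k p))"
      by (intro sum.cong refl ennreal_mult') simp
    finally show ?thesis .
  qed
  have "distr M nu (?T i m) = density nu ?F"
  proof (rule measure_eqI)
    fix S assume "S \<in> sets (distr M nu (?T i m))"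
    then have S: "S \<in> sets borel" by simp
    let ?P = "\<lambda>k. emeasure M {\<omega> \<in> space M. ?T k n \<omega> \<in> S}"
    have pos: "n choose m > 0" using ij by simp
    have "emeasure (density nu ?F) S = (\<integral>\<^sup>+p. ?F p * indicator S p \<partial>nu)"
      using F S by (intro emeasure_density) simp_all
    also have "\<dots> = (\<integral>\<^sup>+p. (\<Sum>k\<in>?K. ennreal (?c k) * (ennreal (?d k p) * indicator S p)) \<partial>nu)"
      unfolding F_eq by (simp only: sum_distrib_right mult.assoc)
    also have "\<dots> = (\<Sum>k\<in>?K. \<integral>\<^sup>+p. ennreal (?c k) * (ennreal (?d k p) * indicator S p) \<partial>nu)"
    proof (rule nn_integral_sum)
      fix k assume "k \<in> ?K"
      note [measurable] = d[OF this] S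
      show "(\<lambda>p. ennreal (?c k) * (ennreal (?d k p) * indicator S p)) \<in> borel_measurable nu"
        by measurable
    qed
    also have "\<dots> = (\<Sum>k\<in>?K. ennreal (?c k) * ?P k)"
    proof (rule sum.cong[OF refl])
      fix k assume k: "k \<in> ?K"
      note [measurable] = d[OF this] S
      have "(\<integral>\<^sup>+p. ennreal (?c k) * (ennreal (?d k p) * indicator S p) \<partial>nu)
          = ennreal (?c k) * (\<integral>\<^sup>+p. ennreal (?d k p) * indicator S p \<partial>nu)"
        by (rule nn_integral_cmult) measurable
      also have "(\<integral>\<^sup>+p. ennreal (?d k p) * indicator S p \<partial>nu) = ?P k"
        using nn_integral_joint_density[OF dens _ j S] k K by blast
      finally show "(\<integral>\<^sup>+p. ennreal (?c k) * (ennreal (?d k p) * indicator S p) \<partial>nu) = ennreal (?c k) * ?P k" .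
    qed
    finally have rhs: "emeasure (density nu ?F) S = (\<Sum>k\<in>?K. ennreal (?c k) * ?P k)" .
    \<comment> \<open>The two measures of \<open>S\<close> are compared after multiplication by
      \<open>n choose m\<close>, which is positive and finite and is cancelled at the end.\<close>
    have "of_nat (n choose m) * emeasure (density nu ?F) S = (\<Sum>k\<in>?K. of_nat (?N k) * ?P k)"
      unfolding rhs sum_distrib_left
    proof (rule sum.cong[OF refl])
      fix k
      have "of_nat (n choose m) * ennreal (?c k) = ennreal (real (n choose m) * ?c k)"
        unfolding ennreal_of_nat_eq_real_of_nat by (rule ennreal_mult[symmetric]) simp_all
      also have "real (n choose m) * ?c k = real (?N k)"
        using pos by simp
      finally show "of_nat (n choose m) * (ennreal (?c k) * ?P k) = of_nat (?N k) * ?P k"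
        by (simp only: mult.assoc[symmetric] ennreal_of_nat_eq_real_of_nat)
    qed
    \<comment> \<open>For ranks outside \<open>?K\<close>, either \<open>k < i\<close> or
      \<open>n - k < m - i\<close>, so one binomial coefficient is 0.\<close>
    also have "\<dots> = (\<Sum>k=1..n. of_nat (?N k) * ?P k)"
    proof (rule sum.mono_neutral_left)
      show "\<forall>k\<in>{1..n} - ?K. of_nat (?N k) * ?P k = 0"
      proof
        fix k assume "k \<in> {1..n} - ?K"
        then have "k - 1 < i - 1 \<or> n - k < m - i" using ij by auto
        then have "?N k = 0" by (auto simp: binomial_eq_0)
        then show "of_nat (?N k) * ?P k = 0" by simp
      qed
    qed (use K in auto)
    also have "\<dots> = of_nat (n choose m) * emeasure (distr M borel (?T i m)) S"
      unfolding ev[OF S] by (rule emeasure_order_stat_mixture[OF assms(2,3) ij S, symmetric])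
    finally have "emeasure (density nu ?F) S = emeasure (distr M borel (?T i m)) S"
      using pos by (simp add: ennreal_mult_cancel_left)
    \<comment> \<open>\<open>nu\<close> and \<open>borel\<close> have the same measurable sets, so
      they are interchangeable as targets of \<open>distr\<close>.\<close>
    also have "distr M borel (?T i m) = distr M nu (?T i m)"
      by (intro distr_cong) simp_all
    finally show "emeasure (distr M nu (?T i m)) S = emeasure (density nu ?F) S" ..
  qed simp
  moreover have "?F \<in> borel_measurable nu"
    using F by (simp cong: measurable_cong_sets)
  moreover have "?T i m \<in> measurable M nu"
    using T by (simp cong: measurable_cong_sets)
  ultimately show "distributed M nu (?T i m) (\<lambda>(x, y). ennreal (\<Sum>k\<in>?K. ?c k * joint_density f g k j x y))"
    unfolding distributed_def case_prod_beta by blast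
qed

end
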